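(* In the case $r=3$ (and $s=2$) one has $$\chi(G(n,3,2))\ge n-1,\qquad n\equiv 0,2,4,5 \pmod 6.$$ Thus the value of $\chi(G(n,3,2))$ is found for infinitely many $n$.
   Context: Let $\mathcal{R}_n=\{0,1,\ldots,n-1\}$ and let $G(n,r,s)$ be the graph whose vertices are all $r$-element subsets of $\mathcal{R}_n$, two vertices $u,v$ being joined by an edge if and only if $|u\cap v|=s$. The chromatic number $\chi(G)$ of a graph $G$ is the least number of colors needed to color its vertices so that the endpoints of every edge have different colors. The paper also proves the following upper bounds: if $p>3$ is a prime such that the congruence $-1\equiv 2^m\pmod p$ holds for no $m$, then $\chi(G(n,3,2))\le n-2$ for $n=p+2$ and $\chi(G(n,3,2))\le n-1$ for $n=p+1$; infinitely many primes $p$ satisfy this condition. *)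

theory Defs
  imports "Graph_Theory.Pair_Digraph" "HOL-Number_Theory.Number_Theory"
begin

(* Undirected graphs are symmetric loop-free digraphs, i.e. instances of pair_graph. *)

definition proper_coloring :: "'a pair_pre_digraph \<Rightarrow> nat \<Rightarrow> ('a \<Rightarrow> nat) \<Rightarrow> bool" where
  "proper_coloring G k c \<longleftrightarrow>
     (\<forall>v \<in> pverts G. c v < k) \<and> (\<forall>(u, v) \<in> parcs G. c u \<noteq> c v)"

(* Meaningful for finite loop-free graphs, which have a proper coloring; see below. *)
definition chromatic_number :: "'a pair_pre_digraph \<Rightarrow> nat" where
  "chromatic_number G = (LEAST k. \<exists>c. proper_coloring G k c)"

(* The condition u \<noteq> v matters only in the degenerate case r = s. *)
definition intersection_graph :: "nat \<Rightarrow> nat \<Rightarrow> nat \<Rightarrow> nat set pair_pre_digraph" where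
  "intersection_graph n r s =
     (let V = {u. u \<subseteq> {0..<n} \<and> card u = r}
      in \<lparr> pverts = V, parcs = {(u, v). u \<in> V \<and> v \<in> V \<and> u \<noteq> v \<and> card (u \<inter> v) = s} \<rparr>)"

definition minus_one_not_power_of_two_primes :: "nat set" where
  "minus_one_not_power_of_two_primes =
     {p. prime p \<and> p > 3 \<and> \<not> (\<exists>m::nat. [- 1 = 2 ^ m] (mod int p))}"

lemma pair_graph_intersection_graph: "pair_graph (intersection_graph n r s)"
proof -
  let ?G = "intersection_graph n r s"
  have sub: "parcs ?G \<subseteq> pverts ?G \<times> pverts ?G"
    by (auto simp: intersection_graph_def Let_def)
  have "pverts ?G \<subseteq> Pow {0..<n}"
    by (auto simp: intersection_graph_def Let_def)
  then have fin: "finite (pverts ?G)"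
    by (rule finite_subset) simp
  have fin': "finite (parcs ?G)"
    by (rule finite_subset[OF sub]) (simp add: fin)
  have "sym (parcs ?G)"
    by (auto simp: intersection_graph_def Let_def sym_def Int_commute)
  then have sym: "symmetric (with_proj ?G)"
    by (simp add: symmetric_def)
  have loopfree: "fst e \<noteq> snd e" if "e \<in> parcs ?G" for e
    using that by (cases e) (simp add: intersection_graph_def Let_def)
  have wf: "pair_wf_digraph ?G"
  proof
    fix e assume "e \<in> parcs ?G"
    with sub have "e \<in> pverts ?G \<times> pverts ?G" by (rule subsetD)
    then show "fst e \<in> pverts ?G" "snd e \<in> pverts ?G"
      by (simp_all add: mem_Times_iff)
  qed
  have "pair_fin_digraph ?G"
    by (rule pair_fin_digraph.intro[OF wf pair_fin_digraph_axioms.intro[OF fin fin']])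
  moreover have "pair_sym_digraph ?G"
    by (rule pair_sym_digraph.intro[OF wf pair_sym_digraph_axioms.intro[OF sym]])
  moreover have "pair_loopfree_digraph ?G"
    by (rule pair_loopfree_digraph.intro[OF wf pair_loopfree_digraph_axioms.intro[OF loopfree]])
  ultimately show ?thesis
    by (intro pair_graph.intro pair_digraph.intro pair_pseudo_graph.intro)
qed

lemma chromatic_number_proper_coloring:
  assumes "pair_graph G"
  shows "\<exists>c. proper_coloring G (chromatic_number G) c"
proof -
  interpret pair_graph G by (rule assms)
  obtain c :: "'a \<Rightarrow> nat" and k where c: "c ` pverts G = {i. i < k}" "inj_on c (pverts G)"
    using finite_imp_inj_to_nat_seg[OF pair_finite_verts] by blast
  have "c v < k" if "v \<in> pverts G" for v
    using c(1) that by blast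
  moreover have "c u \<noteq> c v" if "(u, v) \<in> parcs G" for u v
    using inj_onD[OF c(2)] wellformed'[OF that] pair_no_loops[OF that] by auto
  ultimately have "\<exists>c. proper_coloring G k c"
    unfolding proper_coloring_def by blast
  then show ?thesis
    unfolding chromatic_number_def
    by (rule LeastI[of "\<lambda>k. \<exists>c. proper_coloring G k c"])
qed

end

theory Submission
  imports Defs
begin

text \<open>
  A colour class of \<open>G(n,3,2)\<close> is a packing: a family of triples in which every pair of points
  lies in at most one triple.  Counting pairs, it has at most \<open>n (n - 1) / 6\<close> triples, with equality
  only for a Steiner triple system.  Such systems need every point to lie in exactly \<open>(n - 1) / 2\<close>
  triples (so \<open>n\<close> is odd) and need \<open>n (n - 1) / 6\<close> to be an integer, which excludes the residues
  \<open>0, 2, 4, 5\<close> modulo \<open>6\<close> (\<open>packing_card_less\<close>).  As there are \<open>n (n - 1) (n - 2) / 6\<close> triples in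
  all, \<open>n - 2\<close> colours do not suffice (\<open>colors_lower_bound\<close>).

  For the matching upper bound with \<open>n = p + 1\<close> the points are the residues modulo \<open>p\<close> and one
  extra point \<open>\<infinity>\<close>, represented by the number \<open>p\<close>.  A triple of residues gets its sum as colour.
  A triple \<open>{\<infinity>, u, v}\<close> gets \<open>2 u + v\<close>, that is, the colour of the
  degenerate triple \<open>(u, u, v)\<close>, where \<open>u\<close> and \<open>v\<close> are ordered so that \<open>u - v\<close> lies in a fixed set
  \<open>A\<close> of residues.  This is proper as soon as \<open>A\<close> contains exactly one of \<open>d\<close> and \<open>- d\<close> for each
  nonzero \<open>d\<close> and is closed under doubling: the only dangerous coincidence is
  \<open>2 u + v = 2 w + u\<close>, which says that \<open>u, w, v\<close> is an arithmetic progression.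
  Such an \<open>A\<close> is a union of orbits of doubling, one from each pair of opposite orbits; it exists
  because no orbit is its own negative, \<open>- 1\<close> not being a power of \<open>2\<close>.

  Every prime factor \<open>p\<close> of \<open>2 ^ q - 1\<close>, for an odd prime \<open>q\<close>, has the required property: the order
  of \<open>2\<close> modulo \<open>p\<close> is the odd number \<open>q\<close>.  Also \<open>q\<close> divides \<open>p - 1\<close>, so these
  primes are unbounded.
\<close>

section \<open>Packings of triples and the lower bound\<close>

text \<open>Deleting \<open>x\<close> from the triples through it leaves disjoint pairs.  The rounding
  in \<open>div\<close> is what rules out even \<open>n\<close> below.\<close>

lemma packing_degree_le:
  fixes P :: "'a set set"
  assumes X: "finite X" "x \<in> X"
    and P: "\<And>u. u \<in> P \<Longrightarrow> u \<subseteq> X \<and> card u = 3"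
    and packing: "\<And>u v. u \<in> P \<Longrightarrow> v \<in> P \<Longrightarrow> u \<noteq> v \<Longrightarrow> card (u \<inter> v) \<le> 1"
  shows "card {u \<in> P. x \<in> u} \<le> (card X - 1) div 2"
proof -
  let ?D = "{u \<in> P. x \<in> u}"
  have fin: "finite u" if "u \<in> P" for u
    using P[OF that] X(1) finite_subset by blast
  have finD: "finite ?D"
    by (rule finite_subset[of _ "Pow X"]) (use P X(1) in auto)
  have disj: "(u - {x}) \<inter> (v - {x}) = {}" if "u \<in> ?D" "v \<in> ?D" "u \<noteq> v" for u v
  proof (rule ccontr)
    assume "\<not> ?thesis"
    then obtain y where y: "y \<in> u" "y \<in> v" "y \<noteq> x"
      by blast
    have "card {x, y} \<le> card (u \<inter> v)"
      by (rule card_mono) (use fin that y in auto)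
    with packing[of u v] that y show False
      by simp
  qed
  have "card (\<Union>u\<in>?D. u - {x}) = (\<Sum>u\<in>?D. card (u - {x}))"
    by (rule card_UN_disjoint) (use finD fin disj in auto)
  also have "\<dots> = (\<Sum>u\<in>?D. 2)"
    by (rule sum.cong) (use P fin in auto)
  finally have "2 * card ?D = card (\<Union>u\<in>?D. u - {x})"
    by simp
  also have "\<dots> \<le> card (X - {x})"
    by (rule card_mono) (use X P in auto)
  also have "\<dots> = card X - 1"
    using X by simp
  finally show ?thesis
    by linarith
qed

lemma packing_card_le:
  fixes P :: "'a set set"
  assumes X: "finite X"
    and P: "\<And>u. u \<in> P \<Longrightarrow> u \<subseteq> X \<and> card u = 3"
    and packing: "\<And>u v. u \<in> P \<Longrightarrow> v \<in> P \<Longrightarrow> u \<noteq> v \<Longrightarrow> card (u \<inter> v) \<le> 1"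
  shows "3 * card P \<le> card X * ((card X - 1) div 2)"
proof -
  have finP: "finite P"
    by (rule finite_subset[of _ "Pow X"]) (use P X in auto)
  have "(\<Sum>x\<in>X. card {u \<in> P. x \<in> u}) = (\<Sum>u\<in>P. card {x \<in> X. x \<in> u})"
    by (rule sum_multicount_gen[symmetric]) (use X finP in auto)
  also have "\<dots> = (\<Sum>u\<in>P. 3)"
  proof (rule sum.cong[OF refl])
    fix u assume "u \<in> P"
    with P have "{x \<in> X. x \<in> u} = u" "card u = 3"
      by auto
    then show "card {x \<in> X. x \<in> u} = 3"
      by simp
  qed
  finally have "3 * card P = (\<Sum>x\<in>X. card {u \<in> P. x \<in> u})"
    by simp
  also have "\<dots> \<le> (\<Sum>x\<in>X. (card X - 1) div 2)"
    by (intro sum_mono packing_degree_le X P packing)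
  finally show ?thesis
    by simp
qed

lemma packing_card_less:
  fixes P :: "'a set set"
  assumes X: "finite X" "card X > 0" "card X mod 6 \<in> {0, 2, 4, 5}"
    and P: "\<And>u. u \<in> P \<Longrightarrow> u \<subseteq> X \<and> card u = 3"
    and packing: "\<And>u v. u \<in> P \<Longrightarrow> v \<in> P \<Longrightarrow> u \<noteq> v \<Longrightarrow> card (u \<inter> v) \<le> 1"
  shows "6 * card P < card X * (card X - 1)"
proof -
  define n where "n = card X"
  have le: "3 * card P \<le> n * ((n - 1) div 2)"
    unfolding n_def by (rule packing_card_le[OF X(1) P packing])
  show ?thesis
  proof (cases "even n")
    case True
    have n: "n > 0"
      using X(2) by (simp add: n_def)
    with True have "2 * ((n - 1) div 2) < n - 1"
      by presburger
    with n have "n * (2 * ((n - 1) div 2)) < n * (n - 1)"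
      by simp
    with le show ?thesis
      unfolding n_def[symmetric] by linarith
  next
    case False
    with X(3) have "n mod 6 = 5"
      unfolding n_def[symmetric] by (auto; presburger)
    then obtain m where m: "n = 6 * m + 5"
      by (metis add.commute mod_div_decomp mult.commute)
    define t where "t = 6 * m * m + 9 * m + 3"
    have "n * ((n - 1) div 2) = 3 * t + 1"
      by (simp add: m t_def algebra_simps)
    with le have "card P \<le> t"
      by linarith
    moreover have "n * (n - 1) = 6 * t + 2"
      by (simp add: m t_def algebra_simps)
    ultimately show ?thesis
      unfolding n_def[symmetric] by linarith
  qed
qed

lemma colors_lower_bound:
  assumes n: "n \<ge> 3" "n mod 6 \<in> {0, 2, 4, 5}"
    and c: "proper_coloring (intersection_graph n 3 2) k c"
  shows "k \<ge> n - 1"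
proof (rule ccontr)
  assume "\<not> k \<ge> n - 1"
  then have k: "k \<le> n - 2"
    by linarith
  define V where "V = {u. u \<subseteq> {0..<n} \<and> card u = 3}"
  have col: "c u < k" if "u \<in> V" for u
    using c that by (auto simp: proper_coloring_def intersection_graph_def V_def)
  have proper: "c u \<noteq> c v" if "u \<in> V" "v \<in> V" "u \<noteq> v" "card (u \<inter> v) = 2" for u v
    using c that by (auto simp: proper_coloring_def intersection_graph_def V_def)
  have finV: "finite V"
    by (rule finite_subset[of _ "Pow {0..<n}"]) (auto simp: V_def)
  have triples: "6 * card V = (n - 2) * (n * (n - 1))"
  proof -
    have "card V = n choose 3"
      using n_subsets[of "{0..<n}" 3] by (simp add: V_def)
    moreover obtain j where j: "n = j + 3"
      using n(1) by (metis le_add_diff_inverse2)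
    moreover have "fact (j + 3) = fact j * ((j + 3) * ((j + 2) * (j + 1)))"
      by (simp add: numeral_3_eq_3 algebra_simps)
    moreover have "fact j * (6 * (n choose 3)) = fact n"
      using binomial_fact_lemma[of 3 n] n(1) j by (simp add: fact_numeral ac_simps)
    ultimately have "fact j * (6 * card V) = fact j * ((j + 3) * ((j + 2) * (j + 1)))"
      by simp
    then have "6 * card V = (j + 3) * ((j + 2) * (j + 1))"
      by (simp only: mult_cancel1 fact_nonzero simp_thms)
    with j show ?thesis
      by (simp add: algebra_simps)
  qed
  have class_less: "6 * card {u \<in> V. c u = i} \<le> n * (n - 1) - 1" for i
  proof -
    have "card (u \<inter> v) \<le> 1" if "u \<in> V" "v \<in> V" "c u = c v" "u \<noteq> v" for u v
    proof -
      have fin: "finite u" "finite v"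
        using that by (auto simp: V_def intro: finite_subset)
      have "u \<inter> v \<noteq> u"
        using that fin card_subset_eq[of v u] by (auto simp: V_def)
      then have "card (u \<inter> v) < card u"
        by (intro psubset_card_mono fin) blast
      moreover have "card (u \<inter> v) \<noteq> 2"
        using proper that by blast
      ultimately show ?thesis
        using that by (simp add: V_def)
    qed
    then have "6 * card {u \<in> V. c u = i} < card {0..<n} * (card {0..<n} - 1)"
      by (intro packing_card_less) (use n in \<open>auto simp: V_def\<close>)
    then show ?thesis
      by simp
  qed
  have "V = (\<Union>i<k. {u \<in> V. c u = i})"
    using col by auto
  then have "6 * card V \<le> 6 * (\<Sum>i<k. card {u \<in> V. c u = i})"
    using card_UN_le[of "{..<k}" "\<lambda>i. {u \<in> V. c u = i}"] by simp
  also have "\<dots> = (\<Sum>i<k. 6 * card {u \<in> V. c u = i})"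
    by (simp add: sum_distrib_left)
  also have "\<dots> \<le> (\<Sum>i<k. n * (n - 1) - 1)"
    by (intro sum_mono class_less)
  also have "\<dots> \<le> (n - 2) * (n * (n - 1) - 1)"
    using k by simp
  also have "\<dots> < (n - 2) * (n * (n - 1))"
    using n(1) by simp
  finally show False
    using triples by simp
qed

section \<open>A colouring of the triples on a prime number of points and one more\<close>

text \<open>The chosen half \<open>A\<close> of the nonzero residues consists of the \<open>d\<close> whose orbit under doubling
  has a smaller least representative than the orbit of \<open>- d\<close>.\<close>

definition orbit_min :: "nat \<Rightarrow> int \<Rightarrow> nat" where
  "orbit_min p x = (LEAST r. \<exists>k::nat. [int r = 2 ^ k * x] (mod int p))"

lemma orbit_min_mem:
  assumes "p > 0"
  shows "\<exists>k::nat. [int (orbit_min p x) = 2 ^ k * x] (mod int p)"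
proof -
  have "[int (nat (x mod int p)) = 2 ^ 0 * x] (mod int p)"
    using assms by (simp add: cong_def)
  then have "\<exists>r. \<exists>k::nat. [int r = 2 ^ k * x] (mod int p)"
    by blast
  then show ?thesis
    unfolding orbit_min_def by (rule LeastI_ex)
qed

lemma orbit_min_cong:
  assumes "[x = y] (mod int p)"
  shows "orbit_min p x = orbit_min p y"
proof -
  have "[r = 2 ^ k * x] (mod int p) \<longleftrightarrow> [r = 2 ^ k * y] (mod int p)" for r and k :: nat
    using assms by (metis cong_scalar_left cong_sym cong_trans)
  then show ?thesis
    by (simp add: orbit_min_def)
qed

lemma cong_two_power_pred_prime:
  assumes "prime p" "odd p"
  shows "[2 ^ (p - 1) = 1] (mod int p)"
proof -
  have "\<not> p dvd 2"
    using assms primes_dvd_imp_eq two_is_prime_nat by blast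
  then have "[2 ^ (p - 1) = 1] (mod p)"
    using assms by (intro fermat_theorem) auto
  then show ?thesis
    by (metis cong_int_iff of_nat_1 of_nat_numeral of_nat_power)
qed

text \<open>The orbits are closed under halving as well, since \<open>2 ^ (p - 1) = 1\<close> modulo \<open>p\<close>.\<close>

lemma orbit_min_double:
  assumes "prime p" "odd p"
  shows "orbit_min p (2 * x) = orbit_min p x"
proof -
  have "(\<exists>k::nat. [r = 2 ^ k * (2 * x)] (mod int p)) \<longleftrightarrow> (\<exists>k::nat. [r = 2 ^ k * x] (mod int p))"
    for r
  proof
    assume "\<exists>k::nat. [r = 2 ^ k * (2 * x)] (mod int p)"
    then obtain k :: nat where "[r = 2 ^ k * (2 * x)] (mod int p)" ..
    then have "[r = 2 ^ Suc k * x] (mod int p)"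
      by (simp add: ac_simps)
    then show "\<exists>k::nat. [r = 2 ^ k * x] (mod int p)" ..
  next
    assume "\<exists>k::nat. [r = 2 ^ k * x] (mod int p)"
    then obtain k :: nat where k: "[r = 2 ^ k * x] (mod int p)" ..
    have "[2 ^ k * x * 1 = 2 ^ k * x * 2 ^ (p - 1)] (mod int p)"
      by (intro cong_scalar_left cong_sym[OF cong_two_power_pred_prime] assms)
    moreover obtain j where "p - 1 = Suc j"
      using assms(1) prime_gt_1_nat[of p] by (metis not0_implies_Suc zero_less_diff less_irrefl)
    ultimately have "[2 ^ k * x = 2 ^ (k + j) * (2 * x)] (mod int p)"
      by (simp add: power_add ac_simps)
    with k show "\<exists>k::nat. [r = 2 ^ k * (2 * x)] (mod int p)"
      by (blast intro: cong_trans)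
  qed
  then show ?thesis
    by (simp add: orbit_min_def)
qed

lemma orbit_min_uminus_neq:
  assumes p: "prime p" "odd p"
    and neg: "\<not> (\<exists>m::nat. [- 1 = 2 ^ m] (mod int p))"
    and x: "\<not> [x = 0] (mod int p)"
  shows "orbit_min p (- x) \<noteq> orbit_min p x"
proof
  assume eq: "orbit_min p (- x) = orbit_min p x"
  have "p > 0"
    using p(1) prime_gt_0_nat by blast
  from orbit_min_mem[OF this, of x] orbit_min_mem[OF this, of "- x"] eq
  obtain j k :: nat where "[2 ^ j * x = 2 ^ k * (- x)] (mod int p)"
    by (metis cong_sym cong_trans)
  then have "[2 ^ j * x = (- (2 ^ k)) * x] (mod int p)"
    by simp
  moreover have "coprime x (int p)"
    using p(1) x prime_imp_coprime[of "int p" x] by (auto simp: cong_0_iff coprime_commute)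
  ultimately have jk: "[2 ^ j = - (2 ^ k)] (mod int p)"
    using cong_mult_rcancel by blast
  have one: "[2 ^ (k * (p - 1)) = 1] (mod int p)"
    using cong_pow[OF cong_two_power_pred_prime[OF p], of k]
    by (simp add: power_mult[symmetric] mult.commute)
  have exp: "k * (p - 1) = k + k * (p - 2)"
  proof -
    have "p - 1 = Suc (p - 2)"
      using p(1) prime_gt_1_nat[of p] by linarith
    then show ?thesis
      by simp
  qed
  have "[2 ^ (j + k * (p - 2)) = - (2 ^ k) * 2 ^ (k * (p - 2))] (mod int p)"
    unfolding power_add by (intro cong_scalar_right jk)
  also have "- (2 ^ k) * 2 ^ (k * (p - 2)) = - (2 ^ (k * (p - 1)) :: int)"
    by (simp only: exp power_add mult_minus_left)
  also have "[\<dots> = - 1] (mod int p)"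
    using one by (simp add: cong_minus_minus_iff)
  finally show False
    using neg cong_sym by blast
qed

definition half_residues :: "nat \<Rightarrow> int \<Rightarrow> bool" where
  "half_residues p d \<longleftrightarrow> orbit_min p d < orbit_min p (- d)"

lemma half_residues_cong:
  assumes "[x = y] (mod int p)"
  shows "half_residues p x \<longleftrightarrow> half_residues p y"
proof -
  have "[- x = - y] (mod int p)"
    using assms by (simp only: cong_minus_minus_iff)
  from orbit_min_cong[OF assms] orbit_min_cong[OF this] show ?thesis
    by (simp only: half_residues_def)
qed

lemma half_residues_double:
  assumes "prime p" "odd p"
  shows "half_residues p (2 * d) \<longleftrightarrow> half_residues p d"
  using orbit_min_double[OF assms, of d] orbit_min_double[OF assms, of "- d"]
  by (simp only: half_residues_def mult_minus_right)

lemma half_residues_uminus: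
  assumes "prime p" "odd p" "\<not> (\<exists>m::nat. [- 1 = 2 ^ m] (mod int p))" "\<not> [d = 0] (mod int p)"
  shows "half_residues p (- d) \<longleftrightarrow> \<not> half_residues p d"
  using orbit_min_uminus_neq[OF assms] by (auto simp: half_residues_def)

definition infinity_color :: "nat \<Rightarrow> int \<Rightarrow> int \<Rightarrow> int" where
  "infinity_color p u v = (if half_residues p (u - v) then 2 * u + v else 2 * v + u)"

lemma infinity_color_commute:
  assumes "prime p" "odd p" "\<not> (\<exists>m::nat. [- 1 = 2 ^ m] (mod int p))"
    and "\<not> [u = v] (mod int p)"
  shows "infinity_color p u v = infinity_color p v u"
proof -
  have "\<not> [u - v = 0] (mod int p)"
    using assms(4) by (simp add: cong_diff_iff_cong_0)
  from half_residues_uminus[OF assms(1-3) this] show ?thesis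
    by (simp add: infinity_color_def)
qed

text \<open>When \<open>{u, v}\<close> and \<open>{u, w}\<close> both have \<open>u\<close> first, or both second, equal colours give \<open>v = w\<close>
  by cancelling \<open>2 u\<close>, or \<open>u\<close> and the factor \<open>2\<close>.  The two mixed cases are where closure under doubling is needed.\<close>

lemma infinity_color_inj:
  assumes p: "prime p" "odd p" "\<not> (\<exists>m::nat. [- 1 = 2 ^ m] (mod int p))"
    and ne: "\<not> [u = v] (mod int p)" "\<not> [u = w] (mod int p)" "\<not> [v = w] (mod int p)"
  shows "\<not> [infinity_color p u v = infinity_color p u w] (mod int p)"
proof
  assume eq: "[infinity_color p u v = infinity_color p u w] (mod int p)"
  \<comment> \<open>If \<open>b\<close> is the midpoint of \<open>u\<close> and \<open>a\<close> then \<open>u - a\<close> is twice \<open>u - b\<close>.\<close>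
  have progression: "half_residues p (u - a) \<longleftrightarrow> half_residues p (u - b)"
    if "[u + a = 2 * b] (mod int p)" for a b
  proof -
    have "[u - a = 2 * (u - b)] (mod int p)"
      using that by (simp add: cong_iff_dvd_diff algebra_simps dvd_diff_commute)
    then show ?thesis
      using half_residues_cong half_residues_double[OF p(1,2)] by blast
  qed
  have cancel2: "[v = w] (mod int p)" if "[2 * v = 2 * w] (mod int p)"
    using that p(2) cong_mult_lcancel[of 2 "int p" v w] by (simp add: coprime_left_2_iff_odd)
  show False
  proof (cases "half_residues p (u - v)"; cases "half_residues p (u - w)")
    assume h: "half_residues p (u - v)" "half_residues p (u - w)"
    with eq ne(3) show False
      by (simp add: infinity_color_def cong_add_lcancel)
  next
    assume h: "half_residues p (u - v)" "\<not> half_residues p (u - w)"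
    with eq have "[u + v = 2 * w] (mod int p)"
      by (simp add: infinity_color_def cong_iff_dvd_diff algebra_simps)
    with progression h show False
      by blast
  next
    assume h: "\<not> half_residues p (u - v)" "half_residues p (u - w)"
    with eq have "[u + w = 2 * v] (mod int p)"
      by (simp add: infinity_color_def cong_iff_dvd_diff algebra_simps dvd_diff_commute)
    with progression h show False
      by blast
  next
    assume h: "\<not> half_residues p (u - v)" "\<not> half_residues p (u - w)"
    with eq ne(3) cancel2 show False
      by (simp add: infinity_color_def cong_add_rcancel)
  qed
qed

text \<open>Minimum and maximum only serve to name the two elements of \<open>t - {p}\<close>; their
  order is irrelevant by \<open>infinity_color_commute\<close>.\<close>

definition triple_color :: "nat \<Rightarrow> nat set \<Rightarrow> int" where
  "triple_color p t =
     (if p \<in> t then infinity_color p (int (Min (t - {p}))) (int (Max (t - {p})))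
      else \<Sum>x\<in>t. int x)"

lemma two_set_cases:
  assumes "card (u \<inter> v) = 2" "card u = 3" "card v = 3"
  obtains a b x y where "a \<noteq> b" "x \<notin> {a, b}" "y \<notin> {a, b}" "u = {a, b, x}" "v = {a, b, y}"
proof -
  have fin: "finite u" "finite v"
    using assms by (auto intro: card_ge_0_finite)
  obtain a b where ab: "u \<inter> v = {a, b}" "a \<noteq> b"
    using assms(1) by (meson card_2_iff)
  have "card (u - u \<inter> v) = 1" "card (v - u \<inter> v) = 1"
    using assms fin by (auto simp: card_Diff_subset)
  then obtain x y where "u - u \<inter> v = {x}" "v - u \<inter> v = {y}"
    by (meson card_1_singletonE)
  then have "x \<notin> {a, b}" "y \<notin> {a, b}" "u = {a, b, x}" "v = {a, b, y}"
    using ab by blast+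
  with ab(2) show ?thesis
    using that by blast
qed

lemma triple_color_proper:
  assumes p: "prime p" "odd p" "\<not> (\<exists>m::nat. [- 1 = 2 ^ m] (mod int p))"
    and uv: "u \<subseteq> {0..<p + 1}" "v \<subseteq> {0..<p + 1}" "card u = 3" "card v = 3"
      "u \<noteq> v" "card (u \<inter> v) = 2"
  shows "\<not> [triple_color p u = triple_color p v] (mod int p)"
proof -
  have residue: "\<not> [int x = int y] (mod int p)" if "x < p" "y < p" "x \<noteq> y" for x y
    using that by (simp add: cong_int_iff cong_def)
  have inf: "triple_color p {p, x, y} = infinity_color p (int x) (int y)"
    if "x < p" "y < p" "x \<noteq> y" for x y
  proof -
    have "{p, x, y} - {p} = {x, y}"
      using that by auto
    then show ?thesis
      using that infinity_color_commute[OF p residue[OF that]]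
      by (auto simp: triple_color_def min_def max_def)
  qed
  have fin: "triple_color p {x, y, z} = int x + int y + int z"
    if "x < p" "y < p" "z < p" "x \<noteq> y" "x \<noteq> z" "y \<noteq> z" for x y z
    using that by (simp add: triple_color_def)
  \<comment> \<open>Against a triple of residues only \<open>x\<close> and the repeated point of \<open>2 a + b\<close> are compared.\<close>
  have mixed: "\<not> [infinity_color p (int a) (int b) = int a + int b + int x] (mod int p)"
    if "a < p" "b < p" "x < p" "x \<noteq> a" "x \<noteq> b" for a b x
  proof -
    have "infinity_color p (int a) (int b) \<in> {int a + int b + int a, int a + int b + int b}"
      by (simp add: infinity_color_def)
    then show ?thesis
      using residue[of a x] residue[of b x] that by (metis cong_add_lcancel insertE singletonD)
  qed
  obtain a b x y where abxy: "a \<noteq> b" "x \<notin> {a, b}" "y \<notin> {a, b}"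
    and u: "u = {a, b, x}" and v: "v = {a, b, y}"
    using two_set_cases[OF uv(6,3,4)] .
  have le: "a \<le> p" "b \<le> p" "x \<le> p" "y \<le> p" and xy: "x \<noteq> y"
    using uv u v by auto
  have common: "\<not> [triple_color p {p, a, x} = triple_color p {p, a, y}] (mod int p)"
    if "a < p" "x < p" "y < p" "x \<noteq> a" "y \<noteq> a" for a
    using that xy inf[of a x] inf[of a y]
      infinity_color_inj[OF p residue[of a x] residue[of a y] residue[of x y]] by auto
  consider "a = p" | "b = p" | "x = p" | "y = p" | "a < p" "b < p" "x < p" "y < p"
    using le by linarith
  then show ?thesis
  proof cases
    assume "a = p"
    then show ?thesis
      using common[of b] abxy le u v by auto
  next
    assume "b = p"
    moreover have "{a, b, x} = {b, a, x}" "{a, b, y} = {b, a, y}"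
      by auto
    ultimately show ?thesis
      using common[of a] abxy le u v by auto
  next
    assume x: "x = p"
    have "{a, b, x} = {x, a, b}"
      by auto
    with x show ?thesis
      using mixed[of a b y] inf[of a b] fin[of a b y] abxy le xy u v by auto
  next
    assume y: "y = p"
    have "{a, b, y} = {y, a, b}"
      by auto
    with y show ?thesis
      using mixed[of a b x] inf[of a b] fin[of a b x] abxy le xy u v
      by (auto dest: cong_sym)
  next
    assume "a < p" "b < p" "x < p" "y < p"
    then show ?thesis
      using fin[of a b x] fin[of a b y] residue[of x y] xy abxy u v
      by (auto simp: cong_add_lcancel)
  qed
qed

lemma proper_coloring_prime_plus_one:
  assumes p: "prime p" "odd p" "\<not> (\<exists>m::nat. [- 1 = 2 ^ m] (mod int p))"
  shows "proper_coloring (intersection_graph (p + 1) 3 2) p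
    (\<lambda>t. nat (triple_color p t mod int p))"
proof -
  have "p > 0"
    using p(1) prime_gt_0_nat by blast
  then have "nat (i mod int p) < p" for i
    by (simp add: nat_less_iff)
  moreover have "nat (i mod int p) \<noteq> nat (j mod int p)" if "\<not> [i = j] (mod int p)" for i j
    using that \<open>p > 0\<close> by (auto simp: cong_def eq_nat_nat_iff)
  ultimately show ?thesis
    using triple_color_proper[OF p]
    unfolding proper_coloring_def intersection_graph_def Let_def by auto
qed

section \<open>Infinitely many primes\<close>

text \<open>If \<open>2 ^ q = 1\<close> with \<open>q\<close> odd and \<open>2 ^ m = - 1\<close>, then \<open>2 ^ (m * q)\<close> would be both \<open>1\<close> and
  \<open>- 1\<close>.\<close>

lemma prime_factor_mersenne:
  assumes q: "prime q" "q > 2" and p: "prime p" "p dvd 2 ^ q - 1"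
  shows "p \<in> minus_one_not_power_of_two_primes" "p > q"
proof -
  have "odd q"
    using q prime_odd_nat by blast
  have one: "[2 ^ q = 1] (mod p)"
    using p(2) by (simp add: cong_altdef_nat)
  have "odd p"
  proof
    assume "even p"
    then have "even (2 ^ q - 1 :: nat)"
      using p(2) dvd_trans by blast
    with q show False
      by simp
  qed
  with p(1) have "p > 2"
    using prime_ge_2_nat[of p] by (cases "p = 2") auto
  have ord: "ord p 2 = q"
  proof -
    have "ord p 2 dvd q"
      using one ord_divides by blast
    moreover have "ord p 2 \<noteq> 1"
    proof
      assume "ord p 2 = 1"
      then have "[2 ^ 1 = 1] (mod p)"
        by (metis ord)
      with \<open>p > 2\<close> show False
        by (simp add: cong_def)
    qed
    ultimately show ?thesis
      using q(1) prime_nat_iff by blast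
  qed
  have "[2 ^ (p - 1) = 1] (mod p)"
    using cong_two_power_pred_prime[OF p(1) \<open>odd p\<close>]
    by (metis cong_int_iff of_nat_1 of_nat_numeral of_nat_power)
  then have "q dvd p - 1"
    using ord ord_divides by metis
  with \<open>p > 2\<close> show "p > q"
    using dvd_imp_le[of q "p - 1"] by linarith
  have "\<not> [- 1 = 2 ^ m] (mod int p)" for m :: nat
  proof
    assume "[- 1 = 2 ^ m] (mod int p)"
    then have "[(- 1) ^ q = (2 ^ m) ^ q] (mod int p)"
      by (rule cong_pow)
    then have "[- 1 = (2 ^ q) ^ m] (mod int p)"
      using \<open>odd q\<close> by (simp add: power_mult[symmetric] mult.commute)
    moreover have "[2 ^ q = 1] (mod int p)"
      using one by (metis cong_int_iff of_nat_1 of_nat_numeral of_nat_power)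
    then have "[(2 ^ q) ^ m = 1] (mod int p)"
      by (metis cong_pow power_one)
    ultimately have "[- 1 = 1] (mod int p)"
      by (rule cong_trans)
    then have "int p dvd 2"
      by (simp add: cong_iff_dvd_diff)
    with \<open>p > 2\<close> show False
      using zdvd_imp_le by fastforce
  qed
  with p(1) \<open>p > q\<close> q(2) show "p \<in> minus_one_not_power_of_two_primes"
    by (simp add: minus_one_not_power_of_two_primes_def)
qed

lemma infinite_minus_one_not_power_of_two_primes:
  "infinite minus_one_not_power_of_two_primes"
  unfolding infinite_nat_iff_unbounded
proof
  fix m :: nat
  obtain q where q: "prime q" "q > m + 2"
    using bigger_prime by blast
  have "(2::nat) ^ 2 \<le> 2 ^ q"
    using q(2) by (intro power_increasing) auto
  then have "(2::nat) ^ q - 1 \<noteq> 1"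
    by simp
  then obtain p :: nat where p: "prime p" "p dvd 2 ^ q - 1"
    using prime_factor_nat by blast
  have "p \<in> minus_one_not_power_of_two_primes" "p > q"
    by (rule prime_factor_mersenne; use p q in auto)+
  with q show "\<exists>n>m. n \<in> minus_one_not_power_of_two_primes"
    by (intro exI[of _ p]) auto
qed

section \<open>The chromatic numbers\<close>

lemma chromatic_number_lower_bound:
  assumes "n \<ge> 3" "n mod 6 \<in> {0, 2, 4, 5}"
  shows "chromatic_number (intersection_graph n 3 2) \<ge> n - 1"
  using chromatic_number_proper_coloring[OF pair_graph_intersection_graph]
    colors_lower_bound[OF assms] by blast

lemma chromatic_number_prime_plus_one:
  assumes "p \<in> minus_one_not_power_of_two_primes"
  shows "chromatic_number (intersection_graph (p + 1) 3 2) = p"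
proof (rule antisym)
  have p: "prime p" "p > 3" "\<not> (\<exists>m::nat. [- 1 = 2 ^ m] (mod int p))"
    using assms by (auto simp: minus_one_not_power_of_two_primes_def)
  have "odd p"
    using p prime_odd_nat[of p] by simp
  show "chromatic_number (intersection_graph (p + 1) 3 2) \<le> p"
    unfolding chromatic_number_def
    using proper_coloring_prime_plus_one[OF p(1) \<open>odd p\<close> p(3)] by (blast intro: Least_le)
  have "(p + 1) mod 6 \<in> {0, 2, 4}"
    using \<open>odd p\<close> by simp presburger
  then show "p \<le> chromatic_number (intersection_graph (p + 1) 3 2)"
    using chromatic_number_lower_bound[of "p + 1"] p(2) by auto
qed

theorem mainTheorem5:
  shows "(\<forall>n::nat. n \<ge> 3 \<and> n mod 6 \<in> {0, 2, 4, 5} \<longrightarrow>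
            chromatic_number (intersection_graph n 3 2) \<ge> n - 1)
       \<and> (\<forall>p \<in> minus_one_not_power_of_two_primes.
            chromatic_number (intersection_graph (p + 1) 3 2) = p)
       \<and> infinite minus_one_not_power_of_two_primes"
proof (intro conjI allI ballI impI)
  fix n :: nat
  assume "n \<ge> 3 \<and> n mod 6 \<in> {0, 2, 4, 5}"
  then show "chromatic_number (intersection_graph n 3 2) \<ge> n - 1"
    by (elim conjE) (rule chromatic_number_lower_bound)
next
  fix p assume "p \<in> minus_one_not_power_of_two_primes"
  then show "chromatic_number (intersection_graph (p + 1) 3 2) = p"
    by (rule chromatic_number_prime_plus_one)
next
  show "infinite minus_one_not_power_of_two_primes"
    by (rule infinite_minus_one_not_power_of_two_primes)
qed

end
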